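(* Let $C\ge 2$ and $d\ge 1$ be integers and let $\rho=\sum_{i=0}^d C^i=\frac{C^{d+1}-1}{C-1}$. Consider an instance of \textsc{L-Sided Pricing} with $\mu_u\le C$ for every $u\in L$. Let $p^*$ be an optimal pricing and let $p$ be a pricing that is locally optimal, i.e. $\mathrm{val}(p')\le\mathrm{val}(p)$ for every pricing $p'$ with $\mathrm{HW}(p,p')\le\rho$. Then \[\mathrm{val}(p)\ge\frac{C-C^{-d}}{2C-1-C^{-d}}\cdot\mathrm{val}(p^* ).\]
   Context: An instance of \textsc{L-Sided Pricing} consists of a finite bipartite graph $G=(L\cup R,E)$ (parallel edges allowed, no loops; each edge joins $L$ and $R$), a capacity $\mu_w\in\mathbb Z_{\ge 0}\cup\{\infty\}$ for every vertex $w$, and a budget $b_e\ge 0$ for every edge $e$. For $u\in L$ let $P_u=\{b_e: e\in E\text{ incident to }u\}$. A pricing is a function $p$ on $L$ with $p(u)\in P_u$ for every $u\in L$, extended by $p(v)=0$ for $v\in R$. For a pricing $p$, $\mathrm{val}(p)$ is the maximum of $\sum_{e=uv\in F}(p(u)+p(v))$ over all $F\subseteq E$ such that $p(u)+p(v)\le b_e$ for every $e=uv\in F$ and every vertex $w$ is incident to at most $\mu_w$ edges of $F$. An optimal pricing is a pricing maximizing $\mathrm{val}$. For pricings $p,p'$, $\mathrm{HW}(p,p')=|\{u\in L: p(u)\ne p'(u)\}|$. *)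

theory Defs
  imports Complex_Main "HOL-Library.Extended_Nat"
begin

(* Edges are named objects carrying two endpoint maps, so parallel edges
   (possibly with different budgets) are allowed. *)
record ('v, 'e) pricing_instance =
  left_side :: "'v set"
  right_side :: "'v set"
  edges :: "'e set"
  left_end :: "'e \<Rightarrow> 'v"
  right_end :: "'e \<Rightarrow> 'v"
  capacity :: "'v \<Rightarrow> enat"
  budget :: "'e \<Rightarrow> real"

definition L_sided_pricing_instance :: "('v, 'e) pricing_instance \<Rightarrow> bool" where
  "L_sided_pricing_instance I \<longleftrightarrow>
     finite (left_side I) \<and> finite (right_side I) \<and> finite (edges I) \<and>
     left_side I \<inter> right_side I = {} \<and>
     (\<forall>e \<in> edges I. left_end I e \<in> left_side I \<and> right_end I e \<in> right_side I) \<and>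
     (\<forall>e \<in> edges I. 0 \<le> budget I e)"

definition incident :: "('v, 'e) pricing_instance \<Rightarrow> 'e \<Rightarrow> 'v \<Rightarrow> bool" where
  "incident I e w \<longleftrightarrow> w = left_end I e \<or> w = right_end I e"

definition price_set :: "('v, 'e) pricing_instance \<Rightarrow> 'v \<Rightarrow> real set" where
  "price_set I u = {budget I e | e. e \<in> edges I \<and> incident I e u}"

(* Values of p outside both sides of the graph are irrelevant and left
   unconstrained. *)
definition pricing :: "('v, 'e) pricing_instance \<Rightarrow> ('v \<Rightarrow> real) \<Rightarrow> bool" where
  "pricing I p \<longleftrightarrow>
     (\<forall>u \<in> left_side I. p u \<in> price_set I u) \<and> (\<forall>v \<in> right_side I. p v = 0)"

definition edge_price :: "('v, 'e) pricing_instance \<Rightarrow> ('v \<Rightarrow> real) \<Rightarrow> 'e \<Rightarrow> real" where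
  "edge_price I p e = p (left_end I e) + p (right_end I e)"

definition feasible_sale ::
    "('v, 'e) pricing_instance \<Rightarrow> ('v \<Rightarrow> real) \<Rightarrow> 'e set \<Rightarrow> bool" where
  "feasible_sale I p F \<longleftrightarrow>
     F \<subseteq> edges I \<and>
     (\<forall>e \<in> F. edge_price I p e \<le> budget I e) \<and>
     (\<forall>w \<in> left_side I \<union> right_side I. enat (card {e \<in> F. incident I e w}) \<le> capacity I w)"

definition val :: "('v, 'e) pricing_instance \<Rightarrow> ('v \<Rightarrow> real) \<Rightarrow> real" where
  "val I p = Max {\<Sum>e\<in>F. edge_price I p e | F. feasible_sale I p F}"

(* The maximum defining val is over a finite nonempty set. *)
lemma val_set_finite_nonempty:
  assumes "L_sided_pricing_instance I"
  shows "finite {\<Sum>e\<in>F. edge_price I p e | F. feasible_sale I p F}"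
    and "{\<Sum>e\<in>F. edge_price I p e | F. feasible_sale I p F} \<noteq> {}"
proof -
  have "{F. feasible_sale I p F} \<subseteq> Pow (edges I)"
    by (auto simp: feasible_sale_def)
  moreover have "finite (Pow (edges I))"
    using assms by (simp add: L_sided_pricing_instance_def)
  ultimately have "finite {F. feasible_sale I p F}"
    by (rule finite_subset)
  then show "finite {\<Sum>e\<in>F. edge_price I p e | F. feasible_sale I p F}"
    by simp
  have "feasible_sale I p {}"
    by (simp add: feasible_sale_def zero_enat_def[symmetric])
  then show "{\<Sum>e\<in>F. edge_price I p e | F. feasible_sale I p F} \<noteq> {}"
    by blast
qed

definition optimal_pricing :: "('v, 'e) pricing_instance \<Rightarrow> ('v \<Rightarrow> real) \<Rightarrow> bool" where
  "optimal_pricing I p \<longleftrightarrow> pricing I p \<and> (\<forall>q. pricing I q \<longrightarrow> val I q \<le> val I p)"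

definition HW :: "('v, 'e) pricing_instance \<Rightarrow> ('v \<Rightarrow> real) \<Rightarrow> ('v \<Rightarrow> real) \<Rightarrow> nat" where
  "HW I p q = card {u \<in> left_side I. p u \<noteq> q u}"

definition locally_optimal_pricing ::
    "('v, 'e) pricing_instance \<Rightarrow> nat \<Rightarrow> ('v \<Rightarrow> real) \<Rightarrow> bool" where
  "locally_optimal_pricing I r p \<longleftrightarrow>
     pricing I p \<and> (\<forall>q. pricing I q \<and> HW I p q \<le> r \<longrightarrow> val I q \<le> val I p)"

lemma rho_closed_form:
  fixes C d :: nat
  assumes "2 \<le> C"
  shows "real (\<Sum>i=0..d. C ^ i) = (real C ^ (d + 1) - 1) / (real C - 1)"
  using assms geometric_sum[of "real C" "Suc d"]
  by (simp add: atLeast0AtMost lessThan_Suc_atMost)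

end

theory Submission
  imports Defs
begin

text \<open>
  Let \<open>F\<close> and \<open>G\<close> be optimal sales of the local optimum \<open>p\<close> and of another pricing
  \<open>q\<close>. At each right vertex match as many edges of \<open>G\<close> as possible with edges of
  \<open>F\<close>; a pair \<open>(e, f e)\<close> is an arc from the left end of \<open>e\<close> to that of \<open>f e\<close>. Giving a
  set \<open>S\<close> of left vertices their prices and sales from \<open>q\<close> costs only the edges of \<open>F\<close>
  hit by arcs leaving \<open>S\<close>, so for \<open>|S| \<le> \<rho>\<close> local optimality bounds the gain of \<open>q\<close>
  on \<open>S\<close> by the weight of these arcs. Pad the arcs to a multigraph with all in- and
  out-degrees equal to \<open>C\<close>, and let \<open>m u x\<close> be the number of walks of length at most
  \<open>d\<close> from \<open>u\<close> to \<open>x\<close>. Apply the bound to all level sets \<open>{x. m u x \<ge> t}\<close>, whose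
  size is at most \<open>\<rho>\<close>, and sum over \<open>t\<close> and \<open>u\<close>: every vertex is counted exactly
  \<open>\<rho>\<close> times, and every arc \<open>(x, y)\<close> at most \<open>C ^ d\<close> times, because a walk to \<open>x\<close> of
  length less than \<open>d\<close> extends to \<open>y\<close>. Using level sets instead of balls makes the
  counting exact even when walks collide.
\<close>

section \<open>Regular multigraphs and their walks\<close>

text \<open>Induction on the total deficiency. Row sums and column sums have the same total, so as
  soon as one line falls short of \<open>C\<close>, there are both a deficient row \<open>a\<close>
  and a deficient column \<open>b\<close>. Raising the entry at \<open>(a, b)\<close> by one
  respects all bounds; \<open>a = b\<close>, a loop, is allowed.\<close>

lemma nat_matrix_padding:
  fixes B :: "'a \<Rightarrow> 'a \<Rightarrow> nat"
  assumes fin: "finite V"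
    and "\<And>x. x \<in> V \<Longrightarrow> (\<Sum>y\<in>V. B x y) \<le> C"
    and "\<And>y. y \<in> V \<Longrightarrow> (\<Sum>x\<in>V. B x y) \<le> C"
  shows "\<exists>A. (\<forall>x y. B x y \<le> A x y) \<and> (\<forall>x\<in>V. (\<Sum>y\<in>V. A x y) = C) \<and>
    (\<forall>y\<in>V. (\<Sum>x\<in>V. A x y) = C)"
  using assms(2,3)
proof (induction "C * card V - (\<Sum>x\<in>V. \<Sum>y\<in>V. B x y)" arbitrary: B rule: less_induct)
  case (less B)
  note row = less.prems(1) and col = less.prems(2)
  show ?case
  proof (cases "(\<forall>x\<in>V. (\<Sum>y\<in>V. B x y) = C) \<and> (\<forall>y\<in>V. (\<Sum>x\<in>V. B x y) = C)")
    case True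
    then show ?thesis by blast
  next
    case False
    have swap: "(\<Sum>y\<in>V. \<Sum>x\<in>V. B x y) = (\<Sum>x\<in>V. \<Sum>y\<in>V. B x y)"
      by (rule sum.swap)
    have deficient: "\<exists>i\<in>V. g i < C" if "(\<Sum>i\<in>V. g i) < C * card V" for g :: "'a \<Rightarrow> nat"
    proof (rule ccontr)
      assume "\<not> (\<exists>i\<in>V. g i < C)"
      then have "(\<Sum>i\<in>V. C) \<le> (\<Sum>i\<in>V. g i)" by (intro sum_mono) (auto simp: not_less)
      with that show False by (simp add: mult.commute)
    qed
    have strict: "(\<Sum>i\<in>V. g i) < C * card V"
      if "\<And>i. i \<in> V \<Longrightarrow> g i \<le> C" "j \<in> V" "g j \<noteq> C" for g :: "'a \<Rightarrow> nat" and j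
    proof -
      have "(\<Sum>i\<in>V. g i) < (\<Sum>i\<in>V. C)"
        using that fin by (intro sum_strict_mono_ex1) (auto intro!: bexI[of _ j] simp: order_less_le)
      then show ?thesis by (simp add: mult.commute)
    qed
    have lt: "(\<Sum>x\<in>V. \<Sum>y\<in>V. B x y) < C * card V"
      using False strict[of "\<lambda>x. \<Sum>y\<in>V. B x y"] strict[of "\<lambda>y. \<Sum>x\<in>V. B x y"] row col swap
      by metis
    obtain a where a: "a \<in> V" "(\<Sum>y\<in>V. B a y) < C"
      using deficient lt by blast
    obtain b where b: "b \<in> V" "(\<Sum>x\<in>V. B x b) < C"
      using deficient[of "\<lambda>y. \<Sum>x\<in>V. B x y"] lt swap by auto
    define B' where "B' = (\<lambda>x y. B x y + (if x = a \<and> y = b then 1 else 0))"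
    have row': "(\<Sum>y\<in>V. B' x y) = (\<Sum>y\<in>V. B x y) + (if x = a then 1 else 0)" for x
      using b(1) fin by (simp add: B'_def sum.distrib)
    have col': "(\<Sum>x\<in>V. B' x y) = (\<Sum>x\<in>V. B x y) + (if y = b then 1 else 0)" for y
      using a(1) fin by (simp add: B'_def sum.distrib)
    have tot': "(\<Sum>x\<in>V. \<Sum>y\<in>V. B' x y) = (\<Sum>x\<in>V. \<Sum>y\<in>V. B x y) + 1"
      using a(1) fin by (simp add: row' sum.distrib)
    have "\<exists>A. (\<forall>x y. B' x y \<le> A x y) \<and> (\<forall>x\<in>V. (\<Sum>y\<in>V. A x y) = C) \<and>
      (\<forall>y\<in>V. (\<Sum>x\<in>V. A x y) = C)"
    proof (rule less.hyps)
      show "C * card V - (\<Sum>x\<in>V. \<Sum>y\<in>V. B' x y) < C * card V - (\<Sum>x\<in>V. \<Sum>y\<in>V. B x y)"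
        using lt tot' by linarith
      show "(\<Sum>y\<in>V. B' x y) \<le> C" if "x \<in> V" for x
        using row[OF that] a(2) by (auto simp: row')
      show "(\<Sum>x\<in>V. B' x y) \<le> C" if "y \<in> V" for y
        using col[OF that] b(2) by (auto simp: col')
    qed
    then obtain A where A: "\<forall>x y. B' x y \<le> A x y" "\<forall>x\<in>V. (\<Sum>y\<in>V. A x y) = C"
      "\<forall>y\<in>V. (\<Sum>x\<in>V. A x y) = C" by blast
    have "B x y \<le> A x y" for x y
      using A(1)[rule_format, of x y] by (simp add: B'_def)
    with A(2,3) show ?thesis by blast
  qed
qed

text \<open>For \<open>u\<close> and \<open>x\<close> in \<open>V\<close> this is the
  \<open>(u, x)\<close> entry of the \<open>j\<close>-th power of the matrix \<open>A\<close>, so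
  parallel arcs count as different steps.\<close>

primrec walks :: "'a set \<Rightarrow> ('a \<Rightarrow> 'a \<Rightarrow> nat) \<Rightarrow> nat \<Rightarrow> 'a \<Rightarrow> 'a \<Rightarrow> nat" where
  "walks V A 0 u x = (if u = x then 1 else 0)"
| "walks V A (Suc j) u x = (\<Sum>z\<in>V. walks V A j u z * A z x)"

lemma sum_walks_from:
  assumes "finite V" and "\<And>x. x \<in> V \<Longrightarrow> (\<Sum>y\<in>V. A x y) = C" and "u \<in> V"
  shows "(\<Sum>x\<in>V. walks V A j u x) = C ^ j"
proof (induction j)
  case 0
  then show ?case using assms by simp
next
  case (Suc j)
  have "(\<Sum>x\<in>V. walks V A (Suc j) u x) = (\<Sum>z\<in>V. \<Sum>x\<in>V. walks V A j u z * A z x)"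
    unfolding walks.simps by (rule sum.swap)
  also have "\<dots> = (\<Sum>z\<in>V. walks V A j u z * C)"
    by (simp add: sum_distrib_left[symmetric] assms(2))
  finally show ?case by (simp add: sum_distrib_right[symmetric] Suc)
qed

lemma sum_walks_to:
  assumes "finite V" and "\<And>y. y \<in> V \<Longrightarrow> (\<Sum>x\<in>V. A x y) = C" and "x \<in> V"
  shows "(\<Sum>u\<in>V. walks V A j u x) = C ^ j"
  using assms(3)
proof (induction j arbitrary: x)
  case 0
  then show ?case using assms(1) by simp
next
  case (Suc j)
  have "(\<Sum>u\<in>V. walks V A (Suc j) u x) = (\<Sum>z\<in>V. (\<Sum>u\<in>V. walks V A j u z) * A z x)"
    unfolding walks.simps sum_distrib_right by (rule sum.swap)
  also have "\<dots> = (\<Sum>z\<in>V. C ^ j * A z x)"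
    by (simp add: Suc.IH)
  finally show ?case by (simp add: sum_distrib_left[symmetric] assms(2) Suc.prems)
qed

text \<open>Appending one fixed arc from \<open>x\<close> to \<open>y\<close> sends different walks
  to different walks.\<close>

lemma walks_Suc_ge:
  assumes "finite V" and "x \<in> V" and "0 < A x y"
  shows "walks V A j u x \<le> walks V A (Suc j) u y"
proof -
  have "walks V A j u x \<le> walks V A j u x * A x y" using assms(3) by simp
  also have "\<dots> \<le> (\<Sum>z\<in>V. walks V A j u z * A z y)"
    using assms(1,2) by (intro member_le_sum) auto
  finally show ?thesis by simp
qed

section \<open>Summation over level sets and the averaging argument\<close>

text \<open>Layer-cake summation: a point \<open>x\<close> lies in exactly \<open>m x\<close> of the
  level sets. Level 0, which would be all of \<open>V\<close>, is left out.\<close>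

lemma sum_level_sets:
  fixes z :: "'a \<Rightarrow> real" and m :: "'a \<Rightarrow> nat"
  assumes "finite V" and "\<And>x. x \<in> V \<Longrightarrow> m x \<le> r"
  shows "(\<Sum>t=1..r. \<Sum>x\<in>{x\<in>V. t \<le> m x}. z x) = (\<Sum>x\<in>V. real (m x) * z x)"
proof -
  have "(\<Sum>t=1..r. \<Sum>x\<in>{x\<in>V. t \<le> m x}. z x) = (\<Sum>t=1..r. \<Sum>x\<in>V. if t \<le> m x then z x else 0)"
    using assms(1) by (simp add: sum.inter_filter)
  also have "\<dots> = (\<Sum>x\<in>V. \<Sum>t=1..r. if t \<le> m x then z x else 0)"
    by (rule sum.swap)
  also have "\<dots> = (\<Sum>x\<in>V. real (m x) * z x)"
  proof (rule sum.cong)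
    fix x assume "x \<in> V"
    then have "{t \<in> {1..r}. t \<le> m x} = {1..m x}" using assms(2)[of x] by auto
    then show "(\<Sum>t=1..r. if t \<le> m x then z x else 0) = real (m x) * z x"
      by (simp flip: sum.inter_filter)
  qed simp
  finally show ?thesis .
qed

text \<open>The pair \<open>(x, y)\<close> leaves the level set of \<open>t\<close> exactly when
  \<open>m y < t\<close> and \<open>t \<le> m x\<close>. Truncated subtraction counts these levels,
  giving 0 if \<open>m x \<le> m y\<close>.\<close>

lemma sum_level_set_boundaries:
  fixes w :: "'a \<Rightarrow> 'a \<Rightarrow> real" and m :: "'a \<Rightarrow> nat"
  assumes "finite V" and "\<And>x. x \<in> V \<Longrightarrow> m x \<le> r"
  shows "(\<Sum>t=1..r. \<Sum>x\<in>{x\<in>V. t \<le> m x}. \<Sum>y\<in>V - {x\<in>V. t \<le> m x}. w x y) =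
    (\<Sum>x\<in>V. \<Sum>y\<in>V. real (m x - m y) * w x y)"
proof -
  have compl: "V - {x\<in>V. t \<le> m x} = {y\<in>V. m y < t}" for t by auto
  have "(\<Sum>t=1..r. \<Sum>x\<in>{x\<in>V. t \<le> m x}. \<Sum>y\<in>V - {x\<in>V. t \<le> m x}. w x y) =
    (\<Sum>t=1..r. \<Sum>x\<in>V. \<Sum>y\<in>V. if t \<le> m x \<and> m y < t then w x y else 0)"
    unfolding compl using assms(1) by (auto simp: sum.inter_filter intro!: sum.cong)
  also have "\<dots> = (\<Sum>x\<in>V. \<Sum>y\<in>V. \<Sum>t=1..r. if t \<le> m x \<and> m y < t then w x y else 0)"
    by (subst sum.swap, rule sum.cong, simp, subst sum.swap, simp)
  also have "\<dots> = (\<Sum>x\<in>V. \<Sum>y\<in>V. real (m x - m y) * w x y)"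
  proof (intro sum.cong refl)
    fix x y assume "x \<in> V"
    then have "{t \<in> {1..r}. t \<le> m x \<and> m y < t} = {m y<..m x}" using assms(2)[of x] by auto
    then show "(\<Sum>t=1..r. if t \<le> m x \<and> m y < t then w x y else 0) = real (m x - m y) * w x y"
      by (simp flip: sum.inter_filter)
  qed
  finally show ?thesis .
qed

text \<open>Here \<open>z\<close> is the gain at a vertex, \<open>B\<close> the number of arcs and
  \<open>q\<close> the loss at the head of an arc. The padded matrix \<open>A\<close> serves only to
  count walks; losses remain weighted by \<open>B\<close>, so the added arcs cost nothing.\<close>

lemma local_to_global_exchange:
  fixes B :: "'a \<Rightarrow> 'a \<Rightarrow> nat" and z q :: "'a \<Rightarrow> real"
  assumes fin: "finite V"
    and row: "\<And>x. x \<in> V \<Longrightarrow> (\<Sum>y\<in>V. B x y) \<le> C"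
    and col: "\<And>y. y \<in> V \<Longrightarrow> (\<Sum>x\<in>V. B x y) \<le> C"
    and q: "\<And>y. y \<in> V \<Longrightarrow> 0 \<le> q y"
    and loc: "\<And>S. S \<subseteq> V \<Longrightarrow> card S \<le> (\<Sum>i=0..d. C ^ i) \<Longrightarrow>
      (\<Sum>x\<in>S. z x) \<le> (\<Sum>x\<in>S. \<Sum>y\<in>V - S. real (B x y) * q y)"
  shows "real (\<Sum>i=0..d. C ^ i) * (\<Sum>x\<in>V. z x) \<le>
    real C ^ d * (\<Sum>x\<in>V. \<Sum>y\<in>V. real (B x y) * q y)"
proof -
  define r where "r = (\<Sum>i=0..d. C ^ i)"
  obtain A where AB: "\<And>x y. B x y \<le> A x y"
    and Arow: "\<And>x. x \<in> V \<Longrightarrow> (\<Sum>y\<in>V. A x y) = C"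
    and Acol: "\<And>y. y \<in> V \<Longrightarrow> (\<Sum>x\<in>V. A x y) = C"
    using nat_matrix_padding[of V B C] fin row col by blast
  define m where "m = (\<lambda>u x. \<Sum>j=0..d. walks V A j u x)"
  have m_from: "(\<Sum>x\<in>V. m u x) = r" if "u \<in> V" for u
    unfolding m_def r_def
    by (subst sum.swap) (simp add: sum_walks_from[where C = C] fin Arow that)
  have m_to: "(\<Sum>u\<in>V. m u x) = r" if "x \<in> V" for x
    unfolding m_def r_def
    by (subst sum.swap) (simp add: sum_walks_to[where C = C] fin Acol that)
  have m_le: "m u x \<le> r" if "u \<in> V" "x \<in> V" for u x
    using member_le_sum[of x V "m u"] m_from[OF that(1)] that(2) fin by simp
  have m_diff: "m u x - m u y \<le> walks V A d u x" if "x \<in> V" "0 < A x y" for u x y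
  proof -
    \<comment> \<open>Walks to \<open>x\<close> of length below \<open>d\<close> extend to walks to
      \<open>y\<close> of lengths 1 to \<open>d\<close>, all counted in \<open>m u y\<close>. Only
      the walks of length exactly \<open>d\<close> remain.\<close>
    have "m u x = (\<Sum>j<d. walks V A j u x) + walks V A d u x"
      by (simp add: m_def atLeast0AtMost flip: lessThan_Suc_atMost)
    also have "(\<Sum>j<d. walks V A j u x) \<le> (\<Sum>j<d. walks V A (Suc j) u y)"
      using walks_Suc_ge[OF fin, of x A y, OF that] by (intro sum_mono)
    also have "(\<Sum>j<d. walks V A (Suc j) u y) \<le> m u y"
      unfolding m_def atLeast0AtMost lessThan_Suc_atMost[symmetric] sum.lessThan_Suc_shift
      by simp
    finally show ?thesis by simp
  qed
  have per_source: "(\<Sum>x\<in>V. real (m u x) * z x) \<le>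
      (\<Sum>x\<in>V. \<Sum>y\<in>V. real (walks V A d u x) * (real (B x y) * q y))" if u: "u \<in> V" for u
  proof -
    have "(\<Sum>x\<in>V. real (m u x) * z x) = (\<Sum>t=1..r. \<Sum>x\<in>{x\<in>V. t \<le> m u x}. z x)"
      using sum_level_sets[of V "m u" r z] fin m_le[OF u] by simp
    also have "\<dots> \<le> (\<Sum>t=1..r. \<Sum>x\<in>{x\<in>V. t \<le> m u x}. \<Sum>y\<in>V - {x\<in>V. t \<le> m u x}. real (B x y) * q y)"
    proof (rule sum_mono, rule loc)
      fix t assume t: "t \<in> {1..r}"
      show "{x\<in>V. t \<le> m u x} \<subseteq> V" by blast
      \<comment> \<open>Since \<open>t\<close> is at least 1, every member of the level set
        contributes at least 1 to the total \<open>r\<close> of \<open>m u\<close>.\<close>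
      have "card {x\<in>V. t \<le> m u x} = (\<Sum>x\<in>{x\<in>V. t \<le> m u x}. 1)" by simp
      also have "\<dots> \<le> (\<Sum>x\<in>{x\<in>V. t \<le> m u x}. m u x)" using t by (intro sum_mono) auto
      also have "\<dots> \<le> (\<Sum>x\<in>V. m u x)" using fin by (intro sum_mono2) auto
      finally show "card {x\<in>V. t \<le> m u x} \<le> (\<Sum>i=0..d. C ^ i)"
        using m_from[OF u] by (simp add: r_def)
    qed
    also have "\<dots> = (\<Sum>x\<in>V. \<Sum>y\<in>V. real (m u x - m u y) * (real (B x y) * q y))"
      using fin m_le[OF u] by (rule sum_level_set_boundaries)
    also have "\<dots> \<le> (\<Sum>x\<in>V. \<Sum>y\<in>V. real (walks V A d u x) * (real (B x y) * q y))"
    proof (intro sum_mono)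
      fix x y assume xy: "x \<in> V" "y \<in> V"
      show "real (m u x - m u y) * (real (B x y) * q y) \<le>
        real (walks V A d u x) * (real (B x y) * q y)"
      \<comment> \<open>The bound \<open>m_diff\<close> requires an arc of \<open>A\<close>; where
        \<open>B\<close> has none, both sides vanish.\<close>
      proof (cases "B x y = 0")
        case False
        then have "0 < A x y" using AB[of x y] by linarith
        then show ?thesis
          using m_diff[OF xy(1)] q[OF xy(2)] by (intro mult_right_mono) auto
      qed simp
    qed
    finally show ?thesis .
  qed
  \<comment> \<open>Summing over all sources \<open>u\<close> makes the weights uniform: regularity
    gives \<open>r\<close> at every vertex on the left and \<open>C ^ d\<close> walks of length
    \<open>d\<close> into every tail \<open>x\<close> on the right.\<close>
  have "real r * (\<Sum>x\<in>V. z x) = (\<Sum>x\<in>V. real (\<Sum>u\<in>V. m u x) * z x)"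
    by (simp add: sum_distrib_left m_to del: of_nat_sum)
  also have "\<dots> = (\<Sum>u\<in>V. \<Sum>x\<in>V. real (m u x) * z x)"
    by (subst sum.swap) (simp add: sum_distrib_right)
  also have "\<dots> \<le> (\<Sum>u\<in>V. \<Sum>x\<in>V. \<Sum>y\<in>V. real (walks V A d u x) * (real (B x y) * q y))"
    by (intro sum_mono per_source)
  also have "\<dots> = (\<Sum>x\<in>V. real (\<Sum>u\<in>V. walks V A d u x) * (\<Sum>y\<in>V. real (B x y) * q y))"
    unfolding of_nat_sum sum_distrib_right sum_distrib_left[symmetric] by (rule sum.swap)
  also have "\<dots> = real C ^ d * (\<Sum>x\<in>V. \<Sum>y\<in>V. real (B x y) * q y)"
    by (simp add: sum_walks_to[where C = C] fin Acol sum_distrib_left del: of_nat_sum)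
  finally show ?thesis by (simp add: r_def)
qed

section \<open>Pairing the edges of two sales at each right vertex\<close>

text \<open>Inject the smaller set into the larger one; if that is \<open>Y\<close>, use the inverse
  injection on its image in \<open>X\<close>.\<close>

lemma maximum_partial_injection:
  assumes "finite X" and "finite Y"
  shows "\<exists>D f. D \<subseteq> X \<and> inj_on f D \<and> f ` D \<subseteq> Y \<and> (D = X \<or> f ` D = Y)"
proof (cases "card X \<le> card Y")
  case True
  then obtain f where "f ` X \<subseteq> Y" "inj_on f X" using card_le_inj[OF assms] by blast
  then show ?thesis by blast
next
  case False
  then obtain g where g: "g ` Y \<subseteq> X" "inj_on g Y" using card_le_inj[OF assms(2,1)] by auto
  have "inv_into Y g ` g ` Y = Y" using g(2) by (simp add: image_image)
  moreover have "inj_on (inv_into Y g) (g ` Y)" by (rule inj_on_inv_into) simp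
  ultimately show ?thesis using g(1) by blast
qed

text \<open>Maximum partial injections are chosen in each fibre of \<open>k\<close> and glued. The
  result preserves \<open>k\<close>, so two elements with the same image lie in one fibre, where
  injectivity is known.\<close>

lemma fibrewise_maximum_partial_injection:
  assumes "finite X" and "finite Y"
  obtains D f where "D \<subseteq> X" "inj_on f D" "f ` D \<subseteq> Y" "\<And>e. e \<in> D \<Longrightarrow> k (f e) = k e"
    "\<And>v. {e\<in>X. k e = v} \<subseteq> D \<or> {e\<in>Y. k e = v} \<subseteq> f ` {e\<in>D. k e = v}"
proof -
  have "\<forall>v. \<exists>D f. D \<subseteq> {e\<in>X. k e = v} \<and> inj_on f D \<and> f ` D \<subseteq> {e\<in>Y. k e = v} \<and>
      (D = {e\<in>X. k e = v} \<or> f ` D = {e\<in>Y. k e = v})"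
    using assms by (intro allI maximum_partial_injection) auto
  from choice[OF this] obtain D where "\<forall>v. \<exists>f. D v \<subseteq> {e\<in>X. k e = v} \<and>
      inj_on f (D v) \<and> f ` D v \<subseteq> {e\<in>Y. k e = v} \<and>
      (D v = {e\<in>X. k e = v} \<or> f ` D v = {e\<in>Y. k e = v})" ..
  from choice[OF this] obtain f where f: "\<forall>v. D v \<subseteq> {e\<in>X. k e = v} \<and>
      inj_on (f v) (D v) \<and> f v ` D v \<subseteq> {e\<in>Y. k e = v} \<and>
      (D v = {e\<in>X. k e = v} \<or> f v ` D v = {e\<in>Y. k e = v})" ..
  then have Df: "\<And>v. D v \<subseteq> {e\<in>X. k e = v}" "\<And>v. inj_on (f v) (D v)"
    "\<And>v. f v ` D v \<subseteq> {e\<in>Y. k e = v}"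
    "\<And>v. D v = {e\<in>X. k e = v} \<or> f v ` D v = {e\<in>Y. k e = v}"
    by simp_all
  define E where "E = {e\<in>X. e \<in> D (k e)}"
  define g where "g = (\<lambda>e. f (k e) e)"
  have fib: "{e\<in>E. k e = v} = D v" for v using Df(1)[of v] by (auto simp: E_def)
  have gk: "k (g e) = k e \<and> g e \<in> Y" if "e \<in> E" for e
    using that Df(3)[of "k e"] by (auto simp: E_def g_def)
  have img: "g ` {e\<in>E. k e = v} = f v ` D v" for v
    unfolding fib[symmetric] by (auto simp: g_def)
  have cover: "{e\<in>X. k e = v} \<subseteq> E \<or> {e\<in>Y. k e = v} \<subseteq> g ` {e\<in>E. k e = v}" for v
    using Df(4)[of v] fib[of v] unfolding img by blast
  have "inj_on g E"
  proof (rule inj_onI)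
    fix a b assume ab: "a \<in> E" "b \<in> E" "g a = g b"
    then have "k a = k b" using gk by metis
    then show "a = b" using ab Df(2)[of "k a"] by (auto simp: E_def g_def inj_on_def)
  qed
  moreover have "E \<subseteq> X" "g ` E \<subseteq> Y" using gk by (auto simp: E_def)
  ultimately show thesis using that gk cover by blast
qed

section \<open>Values of pricings and the exchange of sales\<close>

lemma edge_price_pricing:
  assumes "L_sided_pricing_instance I" and "pricing I p" and "e \<in> edges I"
  shows "edge_price I p e = p (left_end I e)"
  using assms by (auto simp: edge_price_def pricing_def L_sided_pricing_instance_def)

lemma pricing_nonneg:
  assumes "L_sided_pricing_instance I" and "pricing I p" and "u \<in> left_side I"
  shows "0 \<le> p u"
  using assms by (fastforce simp: pricing_def price_set_def L_sided_pricing_instance_def)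

lemma val_attained:
  assumes "L_sided_pricing_instance I"
  obtains F where "feasible_sale I p F" and "val I p = (\<Sum>e\<in>F. edge_price I p e)"
  using Max_in[OF val_set_finite_nonempty[OF assms, of p]] by (auto simp: val_def)

lemma val_ge:
  assumes "L_sided_pricing_instance I" and "feasible_sale I p F"
  shows "(\<Sum>e\<in>F. edge_price I p e) \<le> val I p"
  unfolding val_def using assms val_set_finite_nonempty(1)[OF assms(1), of p]
  by (intro Max_ge) auto

lemma incident_left:
  assumes "L_sided_pricing_instance I" and "e \<in> edges I" and "u \<in> left_side I"
  shows "incident I e u \<longleftrightarrow> left_end I e = u"
  using assms by (auto simp: incident_def L_sided_pricing_instance_def)

lemma incident_right:
  assumes "L_sided_pricing_instance I" and "e \<in> edges I" and "v \<in> right_side I"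
  shows "incident I e v \<longleftrightarrow> right_end I e = v"
  using assms by (auto simp: incident_def L_sided_pricing_instance_def)

text \<open>Prices vanish on the right side and each edge has one end on each side, so price and
  incidence each reduce to a single end.\<close>

lemma feasible_sale_iff:
  assumes "L_sided_pricing_instance I" and "pricing I p"
  shows "feasible_sale I p F \<longleftrightarrow> F \<subseteq> edges I \<and>
    (\<forall>e\<in>F. p (left_end I e) \<le> budget I e) \<and>
    (\<forall>u\<in>left_side I. enat (card {e\<in>F. left_end I e = u}) \<le> capacity I u) \<and>
    (\<forall>v\<in>right_side I. enat (card {e\<in>F. right_end I e = v}) \<le> capacity I v)"
proof (cases "F \<subseteq> edges I")
  case True
  have "{e\<in>F. incident I e u} = {e\<in>F. left_end I e = u}" if "u \<in> left_side I" for u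
    using True incident_left[OF assms(1) _ that] by blast
  moreover have "{e\<in>F. incident I e v} = {e\<in>F. right_end I e = v}" if "v \<in> right_side I" for v
    using True incident_right[OF assms(1) _ that] by blast
  moreover have "(\<forall>e\<in>F. edge_price I p e \<le> budget I e) \<longleftrightarrow> (\<forall>e\<in>F. p (left_end I e) \<le> budget I e)"
    using True edge_price_pricing[OF assms] by (metis subsetD)
  ultimately show ?thesis using True unfolding feasible_sale_def by (simp add: ball_Un)
qed (simp add: feasible_sale_def)

lemma sum_edge_price_pricing:
  assumes "L_sided_pricing_instance I" and "pricing I p" and "F \<subseteq> edges I"
  shows "(\<Sum>e\<in>F. edge_price I p e) = (\<Sum>e\<in>F. p (left_end I e))"
  using assms(3) by (intro sum.cong refl edge_price_pricing[OF assms(1,2)]) blast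

text \<open>
  Here \<open>f\<close> pairs edges of \<open>G\<close> with edges of \<open>F\<close> at the same right vertex: selling
  an edge \<open>e\<close> of \<open>G\<close> displaces only \<open>f e\<close>.
\<close>

lemma val_ge_exchange:
  assumes I: "L_sided_pricing_instance I"
    and p: "pricing I p" and q: "pricing I q"
    and F: "feasible_sale I p F" and G: "feasible_sale I q G"
    and D: "D \<subseteq> G" "inj_on f D" "f ` D \<subseteq> F"
    and f_right: "\<And>e. e \<in> D \<Longrightarrow> right_end I (f e) = right_end I e"
    and max: "\<And>v. {e\<in>G. right_end I e = v} \<subseteq> D \<or>
      {e\<in>F. right_end I e = v} \<subseteq> f ` {e\<in>D. right_end I e = v}"
    and S: "S \<subseteq> left_side I"
  defines "p' \<equiv> \<lambda>x. if x \<in> S then q x else p x"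
  shows "pricing I p'" and "HW I p p' \<le> card S"
    and "(\<Sum>e\<in>{e\<in>G. left_end I e \<in> S}. q (left_end I e)) +
        (\<Sum>e\<in>{e\<in>F. left_end I e \<notin> S}. p (left_end I e)) -
        (\<Sum>e\<in>{e\<in>D. left_end I e \<in> S \<and> left_end I (f e) \<notin> S}. p (left_end I (f e))) \<le> val I p'"
proof -
  have fin: "finite (left_side I)" "finite (edges I)" "left_side I \<inter> right_side I = {}"
    using I by (auto simp: L_sided_pricing_instance_def)
  have FG: "F \<subseteq> edges I" "G \<subseteq> edges I" using F G by (auto simp: feasible_sale_def)
  have finFG: "finite F" "finite G" "finite D"
    using FG fin(2) D(1) by (meson finite_subset)+
  show p': "pricing I p'"
    using p q S fin(3) by (auto simp: pricing_def p'_def)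
  have "{u \<in> left_side I. p u \<noteq> p' u} \<subseteq> S" by (auto simp: p'_def)
  then show "HW I p p' \<le> card S"
    unfolding HW_def using S fin(1) by (intro card_mono) (auto intro: finite_subset)
  \<comment> \<open>The new sale is \<open>G1 \<union> F1\<close>. Edges of \<open>F\<close> with
    left end in \<open>S\<close> are given up in any case; \<open>K\<close> collects the further
    displaced edges, those with left end outside \<open>S\<close>.\<close>
  define G1 where "G1 = {e\<in>G. left_end I e \<in> S}"
  define K where "K = f ` {e\<in>D. left_end I e \<in> S \<and> left_end I (f e) \<notin> S}"
  define F0 where "F0 = {e\<in>F. left_end I e \<notin> S}"
  define F1 where "F1 = F0 - K"
  have finF1: "finite G1" "finite F0" "finite F1" "G1 \<inter> F1 = {}" "K \<subseteq> F0"
    using finFG D(3) by (auto simp: G1_def F1_def F0_def K_def)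
  have "feasible_sale I p' (G1 \<union> F1)"
    unfolding feasible_sale_iff[OF I p']
  proof (intro conjI ballI)
    show "G1 \<union> F1 \<subseteq> edges I" using FG by (auto simp: G1_def F1_def F0_def)
    show "p' (left_end I e) \<le> budget I e" if "e \<in> G1 \<union> F1" for e
      using that F G unfolding feasible_sale_iff[OF I p] feasible_sale_iff[OF I q]
      by (auto simp: p'_def G1_def F1_def F0_def)
    show "enat (card {e \<in> G1 \<union> F1. left_end I e = u}) \<le> capacity I u" if u: "u \<in> left_side I" for u
    proof (cases "u \<in> S")
      case True
      then have "card {e \<in> G1 \<union> F1. left_end I e = u} \<le> card {e\<in>G. left_end I e = u}"
        using finFG by (intro card_mono) (auto simp: G1_def F1_def F0_def)
      then show ?thesis
        using G u unfolding feasible_sale_iff[OF I q] by (meson enat_ord_simps(1) order_trans)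
    next
      case False
      then have "card {e \<in> G1 \<union> F1. left_end I e = u} \<le> card {e\<in>F. left_end I e = u}"
        using finFG by (intro card_mono) (auto simp: G1_def F1_def F0_def)
      then show ?thesis
        using F u unfolding feasible_sale_iff[OF I p] by (meson enat_ord_simps(1) order_trans)
    qed
    show "enat (card {e \<in> G1 \<union> F1. right_end I e = v}) \<le> capacity I v" if v: "v \<in> right_side I" for v
    proof -
      let ?G = "{e\<in>G1. right_end I e = v}" and ?F = "{e\<in>F1. right_end I e = v}"
      have split: "{e \<in> G1 \<union> F1. right_end I e = v} = ?G \<union> ?F" by blast
      have le: "card (?G \<union> ?F) \<le> card ?G + card ?F" by (rule card_Un_le)
      show ?thesis using max[of v]
      proof
        \<comment> \<open>All edges of \<open>G\<close> at \<open>v\<close> have partners. Replace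
          each edge of \<open>G1\<close> at \<open>v\<close> by its partner: the partners are
          distinct and lie outside \<open>F1\<close>, so the degree at \<open>v\<close> is at most
          that of \<open>F\<close>.\<close>
        assume sub: "{e\<in>G. right_end I e = v} \<subseteq> D"
        have GD: "?G \<subseteq> D" using sub by (auto simp: G1_def)
        have "card ?G = card (f ` ?G)"
          using card_image[OF inj_on_subset[OF D(2) GD]] by (rule sym)
        moreover have "f ` ?G \<inter> ?F = {}"
          using GD by (auto simp: F1_def F0_def K_def G1_def)
        ultimately have "card ?G + card ?F = card (f ` ?G \<union> ?F)"
          using finF1 by (simp add: card_Un_disjoint)
        also have "\<dots> \<le> card {e\<in>F. right_end I e = v}"
          using finFG GD D(3) f_right by (intro card_mono) (auto simp: F1_def F0_def)
        finally show ?thesis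
          using F v le unfolding feasible_sale_iff[OF I p] split
          by (meson enat_ord_simps(1) order_trans)
      next
        \<comment> \<open>Now every edge of \<open>F\<close> at \<open>v\<close> is a partner. Those
          surviving in \<open>F1\<close> are replaced by their preimages, which lie in
          \<open>G\<close> but not in \<open>G1\<close>, so the degree at \<open>v\<close> is at
          most that of \<open>G\<close>.\<close>
        assume sub: "{e\<in>F. right_end I e = v} \<subseteq> f ` {e\<in>D. right_end I e = v}"
        let ?X = "{e\<in>D. right_end I e = v \<and> f e \<in> F1}"
        have "?F \<subseteq> f ` ?X" using sub by (auto simp: F1_def F0_def)
        then have "card ?F \<le> card ?X"
          using finFG by (intro surj_card_le[of _ _ f]) auto
        moreover have "?G \<inter> ?X = {}" by (auto simp: F1_def F0_def K_def G1_def)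
        then have "card ?G + card ?X = card (?G \<union> ?X)"
          using finF1 finFG by (simp add: card_Un_disjoint)
        moreover have "card (?G \<union> ?X) \<le> card {e\<in>G. right_end I e = v}"
          using finFG D(1) by (intro card_mono) (auto simp: G1_def)
        ultimately have "card (?G \<union> ?F) \<le> card {e\<in>G. right_end I e = v}" using le by linarith
        then show ?thesis
          using G v unfolding feasible_sale_iff[OF I q] split
          by (meson enat_ord_simps(1) order_trans)
      qed
    qed
  qed
  then have "(\<Sum>e\<in>G1 \<union> F1. p' (left_end I e)) \<le> val I p'"
    using val_ge[OF I] sum_edge_price_pricing[OF I p'] by (metis feasible_sale_def)
  moreover have "(\<Sum>e\<in>G1 \<union> F1. p' (left_end I e)) =
      (\<Sum>e\<in>G1. q (left_end I e)) + (\<Sum>e\<in>F1. p (left_end I e))"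
    using finF1 by (subst sum.union_disjoint)
      (auto simp: p'_def G1_def F1_def F0_def intro!: arg_cong2[where f = "(+)"] sum.cong)
  moreover have "(\<Sum>e\<in>F1. p (left_end I e)) = (\<Sum>e\<in>F0. p (left_end I e)) - (\<Sum>e\<in>K. p (left_end I e))"
    unfolding F1_def using finF1 by (intro sum_diff) auto
  moreover have "(\<Sum>e\<in>K. p (left_end I e)) =
      (\<Sum>e\<in>{e\<in>D. left_end I e \<in> S \<and> left_end I (f e) \<notin> S}. p (left_end I (f e)))"
    unfolding K_def using D(2) by (subst sum.reindex) (auto simp: inj_on_def)
  ultimately show "(\<Sum>e\<in>{e\<in>G. left_end I e \<in> S}. q (left_end I e)) +
        (\<Sum>e\<in>{e\<in>F. left_end I e \<notin> S}. p (left_end I e)) -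
        (\<Sum>e\<in>{e\<in>D. left_end I e \<in> S \<and> left_end I (f e) \<notin> S}. p (left_end I (f e))) \<le> val I p'"
    by (simp add: G1_def F0_def)
qed

section \<open>From local optimality to the approximation ratio\<close>

text \<open>Passes from arc multiplicities between vertices to the individual pairs
  \<open>(e, f e)\<close>, by grouping \<open>D\<close> according to both ends of its arcs.\<close>

lemma sum_double_fibre:
  fixes h :: "'b \<Rightarrow> real"
  assumes "finite D" and "finite X" and "finite Y"
  shows "(\<Sum>x\<in>X. \<Sum>y\<in>Y. real (card {e\<in>D. a e = x \<and> b e = y}) * h y) =
    (\<Sum>e\<in>{e\<in>D. a e \<in> X \<and> b e \<in> Y}. h (b e))"
proof -
  have "(\<Sum>x\<in>X. \<Sum>y\<in>Y. real (card {e\<in>D. a e = x \<and> b e = y}) * h y) =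
    (\<Sum>x\<in>X. \<Sum>y\<in>Y. \<Sum>e\<in>D. if a e = x \<and> b e = y then h (b e) else 0)"
  proof (intro sum.cong refl)
    fix x y
    have "(\<Sum>e\<in>D. if a e = x \<and> b e = y then h (b e) else 0) =
      (\<Sum>e\<in>{e\<in>D. a e = x \<and> b e = y}. h (b e))"
      using assms(1) by (rule sum.inter_filter[symmetric])
    also have "\<dots> = (\<Sum>e\<in>{e\<in>D. a e = x \<and> b e = y}. h y)" by (rule sum.cong) auto
    also have "\<dots> = real (card {e\<in>D. a e = x \<and> b e = y}) * h y" by simp
    finally show "real (card {e\<in>D. a e = x \<and> b e = y}) * h y =
      (\<Sum>e\<in>D. if a e = x \<and> b e = y then h (b e) else 0)" by (rule sym)
  qed
  also have "\<dots> = (\<Sum>e\<in>D. \<Sum>x\<in>X. \<Sum>y\<in>Y. if a e = x \<and> b e = y then h (b e) else 0)"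
    by (subst (2) sum.swap, subst sum.swap, rule refl)
  also have "\<dots> = (\<Sum>e\<in>D. if a e \<in> X \<and> b e \<in> Y then h (b e) else 0)"
  proof (intro sum.cong refl)
    fix e
    have "(\<Sum>x\<in>X. \<Sum>y\<in>Y. if a e = x \<and> b e = y then h (b e) else 0) =
      (\<Sum>x\<in>X. if a e = x then (\<Sum>y\<in>Y. if b e = y then h (b e) else 0) else 0)"
      by (intro sum.cong) auto
    then show "(\<Sum>x\<in>X. \<Sum>y\<in>Y. if a e = x \<and> b e = y then h (b e) else 0) =
      (if a e \<in> X \<and> b e \<in> Y then h (b e) else 0)"
      using assms(2,3) by simp
  qed
  finally show ?thesis using assms(1) by (simp add: sum.inter_filter)
qed

text \<open>The gains at the left vertices add up to \<open>val I q - val I p\<close>, and the arcs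
  hit distinct edges of \<open>F\<close>, so they weigh at most \<open>val I p\<close>. The
  averaging argument links the two quantities.\<close>

lemma locally_optimal_val_bound:
  assumes I: "L_sided_pricing_instance I"
    and cap: "\<And>u. u \<in> left_side I \<Longrightarrow> capacity I u \<le> enat C"
    and q: "pricing I q"
    and opt: "locally_optimal_pricing I (\<Sum>i=0..d. C ^ i) p"
  shows "real (\<Sum>i=0..d. C ^ i) * (val I q - val I p) \<le> real C ^ d * val I p"
proof -
  let ?L = "left_side I" and ?l = "left_end I"
  have p: "pricing I p"
    and opt': "\<And>p'. pricing I p' \<Longrightarrow> HW I p p' \<le> (\<Sum>i=0..d. C ^ i) \<Longrightarrow> val I p' \<le> val I p"
    using opt by (auto simp: locally_optimal_pricing_def)
  have fin: "finite ?L" "finite (edges I)"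
    and lL: "\<And>e. e \<in> edges I \<Longrightarrow> ?l e \<in> ?L"
    using I by (auto simp: L_sided_pricing_instance_def)
  obtain F where F: "feasible_sale I p F" "val I p = (\<Sum>e\<in>F. edge_price I p e)"
    using val_attained[OF I] .
  obtain G where G: "feasible_sale I q G" "val I q = (\<Sum>e\<in>G. edge_price I q e)"
    using val_attained[OF I] .
  have FG: "F \<subseteq> edges I" "G \<subseteq> edges I" using F G by (auto simp: feasible_sale_def)
  have finFG: "finite F" "finite G" using FG fin by (auto intro: finite_subset)
  have valp: "val I p = (\<Sum>e\<in>F. p (?l e))" and valq: "val I q = (\<Sum>e\<in>G. q (?l e))"
    using F(2) G(2) sum_edge_price_pricing[OF I] p q FG by auto
  have degF: "card {e\<in>F. ?l e = u} \<le> C" if "u \<in> ?L" for u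
    using F(1) that cap[OF that] unfolding feasible_sale_iff[OF I p]
    by (meson enat_ord_simps(1) order_trans)
  have degG: "card {e\<in>G. ?l e = u} \<le> C" if "u \<in> ?L" for u
    using G(1) that cap[OF that] unfolding feasible_sale_iff[OF I q]
    by (meson enat_ord_simps(1) order_trans)
  obtain D f where D: "D \<subseteq> G" "inj_on f D" "f ` D \<subseteq> F"
    "\<And>e. e \<in> D \<Longrightarrow> right_end I (f e) = right_end I e"
    "\<And>v. {e\<in>G. right_end I e = v} \<subseteq> D \<or>
      {e\<in>F. right_end I e = v} \<subseteq> f ` {e\<in>D. right_end I e = v}"
    using fibrewise_maximum_partial_injection[OF finFG(2,1), of "right_end I"] by blast
  have finD: "finite D" using D(1) finFG by (auto intro: finite_subset)
  have DL: "?l e \<in> ?L" "?l (f e) \<in> ?L" if "e \<in> D" for e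
    using that D(1,3) FG lL by blast+
  define B where "B = (\<lambda>x y. card {e\<in>D. ?l e = x \<and> ?l (f e) = y})"
  define z where "z = (\<lambda>x. (\<Sum>e\<in>{e\<in>G. ?l e = x}. q (?l e)) - (\<Sum>e\<in>{e\<in>F. ?l e = x}. p (?l e)))"
  have z_sum: "(\<Sum>x\<in>S. z x) =
      (\<Sum>e\<in>{e\<in>G. ?l e \<in> S}. q (?l e)) - (\<Sum>e\<in>{e\<in>F. ?l e \<in> S}. p (?l e))" if "S \<subseteq> ?L" for S
  proof -
    have "finite S" using that fin by (auto intro: finite_subset)
    have "(\<Sum>x\<in>S. \<Sum>e\<in>{e\<in>H. ?l e = x}. h e) = (\<Sum>e\<in>{e\<in>H. ?l e \<in> S}. h e)"
      if "finite H" for H and h :: "'b \<Rightarrow> real"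
    proof -
      have "(\<Sum>x\<in>S. \<Sum>e\<in>{e\<in>H. ?l e = x}. h e) =
          (\<Sum>x\<in>S. \<Sum>e\<in>{e\<in>{e\<in>H. ?l e \<in> S}. ?l e = x}. h e)"
        by (intro sum.cong) auto
      also have "\<dots> = (\<Sum>e\<in>{e\<in>H. ?l e \<in> S}. h e)"
        using that \<open>finite S\<close> by (intro sum.group) auto
      finally show ?thesis .
    qed
    then show ?thesis using finFG by (simp only: z_def sum_subtractf)
  qed
  have row: "(\<Sum>y\<in>?L. B x y) \<le> C" if "x \<in> ?L" for x
  proof -
    have "(\<Sum>y\<in>?L. B x y) = card (\<Union>y\<in>?L. {e\<in>D. ?l e = x \<and> ?l (f e) = y})"
      unfolding B_def using fin finD by (subst card_UN_disjoint) auto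
    also have "\<dots> \<le> card {e\<in>G. ?l e = x}"
      using finFG D(1) by (intro card_mono) auto
    finally show ?thesis using degG[OF that] by linarith
  qed
  have col: "(\<Sum>x\<in>?L. B x y) \<le> C" if "y \<in> ?L" for y
  proof -
    have "(\<Sum>x\<in>?L. B x y) = card (\<Union>x\<in>?L. {e\<in>D. ?l e = x \<and> ?l (f e) = y})"
      unfolding B_def using fin finD by (subst card_UN_disjoint) auto
    also have "\<dots> \<le> card {e\<in>F. ?l e = y}"
      \<comment> \<open>Injectivity of \<open>f\<close> bounds the arcs into \<open>y\<close> by the
        edges of \<open>F\<close> at \<open>y\<close>; the arcs out of \<open>x\<close> were bounded
        by edges of \<open>G\<close>.\<close>
      using finFG D(2,3) by (intro card_inj_on_le[of f]) (auto intro: inj_on_subset)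
    finally show ?thesis using degF[OF that] by linarith
  qed
  have "real (\<Sum>i=0..d. C ^ i) * (\<Sum>x\<in>?L. z x) \<le>
    real C ^ d * (\<Sum>x\<in>?L. \<Sum>y\<in>?L. real (B x y) * p y)"
  proof (rule local_to_global_exchange[OF fin(1) row col pricing_nonneg[OF I p]])
    fix S assume S: "S \<subseteq> ?L" "card S \<le> (\<Sum>i=0..d. C ^ i)"
    note ex = val_ge_exchange[OF I p q F(1) G(1) D S(1)]
    have "finite S" using S(1) fin by (auto intro: finite_subset)
    then have "(\<Sum>x\<in>S. \<Sum>y\<in>?L - S. real (B x y) * p y) =
        (\<Sum>e\<in>{e\<in>D. ?l e \<in> S \<and> ?l (f e) \<in> ?L - S}. p (?l (f e)))"
      unfolding B_def using finD fin by (intro sum_double_fibre) auto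
    moreover have "{e\<in>D. ?l e \<in> S \<and> ?l (f e) \<in> ?L - S} = {e\<in>D. ?l e \<in> S \<and> ?l (f e) \<notin> S}"
      using DL by auto
    \<comment> \<open>Splitting the old sale along \<open>S\<close> lets its part outside
      \<open>S\<close> cancel against the same term in the exchange bound.\<close>
    moreover have "val I p = (\<Sum>e\<in>{e\<in>F. ?l e \<in> S}. p (?l e)) + (\<Sum>e\<in>{e\<in>F. ?l e \<notin> S}. p (?l e))"
      unfolding valp using finFG by (subst sum.union_disjoint[symmetric]) (auto intro: sum.cong)
    ultimately show "(\<Sum>x\<in>S. z x) \<le> (\<Sum>x\<in>S. \<Sum>y\<in>?L - S. real (B x y) * p y)"
      using ex(3) opt'[OF ex(1)] ex(2) S z_sum[OF S(1)] by simp
  qed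
  moreover have "(\<Sum>x\<in>?L. z x) = val I q - val I p"
  proof -
    have "{e\<in>G. ?l e \<in> ?L} = G" "{e\<in>F. ?l e \<in> ?L} = F" using FG lL by auto
    then show ?thesis using z_sum[of ?L] by (simp add: valp valq)
  qed
  moreover have "(\<Sum>x\<in>?L. \<Sum>y\<in>?L. real (B x y) * p y) \<le> val I p"
  proof -
    have "(\<Sum>x\<in>?L. \<Sum>y\<in>?L. real (B x y) * p y) = (\<Sum>e\<in>{e\<in>D. ?l e \<in> ?L \<and> ?l (f e) \<in> ?L}. p (?l (f e)))"
      unfolding B_def using finD fin by (intro sum_double_fibre) auto
    also have "{e\<in>D. ?l e \<in> ?L \<and> ?l (f e) \<in> ?L} = D" using DL by auto
    also have "(\<Sum>e\<in>D. p (?l (f e))) = (\<Sum>e\<in>f ` D. p (?l e))"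
      using D(2) by (simp add: sum.reindex)
    also have "\<dots> \<le> (\<Sum>e\<in>F. p (?l e))"
      using finFG D(3) FG lL pricing_nonneg[OF I p] by (intro sum_mono2) blast+
    finally show ?thesis by (simp add: valp)
  qed
  ultimately show ?thesis
    by (metis (no_types, lifting) mult_left_mono of_nat_0_le_iff order_trans zero_le_power)
qed

theorem theorem10:
  fixes I :: "('v, 'e) pricing_instance"
    and C d \<rho> :: nat
    and p p_opt :: "'v \<Rightarrow> real"
  assumes "2 \<le> C" and "1 \<le> d"
    and "\<rho> = (\<Sum>i=0..d. C ^ i)"
    and "L_sided_pricing_instance I"
    and "\<forall>u \<in> left_side I. capacity I u \<le> enat C"
    and "optimal_pricing I p_opt"
    and "locally_optimal_pricing I \<rho> p"
  shows "val I p \<ge>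
    (real C - 1 / real C ^ d) / (2 * real C - 1 - 1 / real C ^ d) * val I p_opt"
proof -
  define c k where "c = real C" and "k = c ^ d"
  have c: "2 \<le> c" using assms(1) by (simp add: c_def)
  have k: "1 \<le> k" using c by (simp add: k_def)
  have \<rho>: "real \<rho> = (c * k - 1) / (c - 1)"
    using rho_closed_form[OF assms(1), of d] assms(3) by (simp add: c_def k_def)
  have "real \<rho> * (val I p_opt - val I p) \<le> k * val I p"
    using locally_optimal_val_bound[of I C p_opt d p] assms
    by (simp add: optimal_pricing_def c_def k_def)
  then have "(c - 1) * (real \<rho> * (val I p_opt - val I p)) \<le> (c - 1) * (k * val I p)"
    using c by (intro mult_left_mono) auto
  \<comment> \<open>Multiplying by \<open>c - 1\<close> clears the denominator of the geometric sum;
    collecting the \<open>val I p\<close> terms then gives the coefficient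
    \<open>(c * k - 1) + (c - 1) * k\<close>.\<close>
  moreover have "(c - 1) * (real \<rho> * (val I p_opt - val I p)) = (c * k - 1) * (val I p_opt - val I p)"
    using c by (simp add: \<rho>)
  ultimately have main: "(c * k - 1) * val I p_opt \<le> (2 * c * k - k - 1) * val I p"
    by (simp add: algebra_simps)
  have "2 * k \<le> c * k" using c k by (intro mult_right_mono) auto
  then have pos: "0 < 2 * c * k - k - 1" using k by linarith
  \<comment> \<open>Expanding the stated ratio by \<open>k = c ^ d\<close> yields the coefficients
    of \<open>main\<close>.\<close>
  have "(c - 1 / k) / (2 * c - 1 - 1 / k) = (c * k - 1) / (2 * c * k - k - 1)"
  proof -
    have "c - 1 / k = (c * k - 1) / k" "2 * c - 1 - 1 / k = (2 * c * k - k - 1) / k"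
      using k by (simp_all add: field_simps)
    then show ?thesis using k by simp
  qed
  moreover have "(c * k - 1) / (2 * c * k - k - 1) * val I p_opt \<le> val I p"
    using main pos by (simp add: pos_divide_le_eq mult.commute)
  ultimately show ?thesis by (simp add: c_def k_def)
qed

end
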